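(* Assume that $T$ and the random operators $\{\widehat T_n\}_{n\ge1}$ satisfy: (1) $P(\lim_{n\to\infty}\|\widehat T_n v-Tv\|\ge\epsilon)=0$ for all $\epsilon>0$ and all $v\in\mathbb{R}^{|\mathbb{S}|}$ (i.e. $\widehat T_n(\omega)v\to Tv$ for $P$-almost all $\omega$), and $T$ has a fixed point $v^*$, $Tv^*=v^*$; (2) there is $\kappa^*<\infty$ with $\|v^*\|\le\kappa^*$ such that $\|\hat v_n^k\|\le\kappa^*$ almost surely for all $k\ge0$, $n\ge1$ (for seeds $\hat v_n^0$ with $\|\hat v_n^0\|\le\kappa^*$); (3) $\|Tv-v^*\|\le\alpha\|v-v^*\|$ for all $v\in\mathbb{R}^{|\mathbb{S}|}$; (4) for every $\epsilon>0$ there is a sequence $\{p_n(\epsilon)\}_{n\ge1}$ with $P(\|Tv-\widehat T_nv\|<\epsilon)>p_n(\epsilon)$ for all $v$ with $\|v\|\le\kappa^*$, and $p_n(\epsilon)\uparrow1$ as $n\to\infty$. Let $\{X_n^k\}_{k\ge0}$ and $\{Y_n^k\}_{k\ge0}$ be the processes defined in the context. If $X_n^0=Y_n^0$, then $X_n^k\le_{st}Y_n^k$ for all $k\ge0$.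
   Context: $\mathbb{S}$ is a finite set, $\|\cdot\|$ the sup norm on $\mathbb{R}^{|\mathbb{S}|}$, $\alpha\in(0,1)$ a constant, $T:\mathbb{R}^{|\mathbb{S}|}\to\mathbb{R}^{|\mathbb{S}|}$ a deterministic operator. $\Omega=[0,1]^\infty$ with its product Borel $\sigma$-algebra $\mathcal F$ and the law $P$ of an i.i.d. sequence of uniform $[0,1]$ variables. For each $n\ge1$, $\widehat T_n$ is a random operator: for each $\omega\in\Omega$, $\widehat T_n(\omega)$ is a map $\mathbb{R}^{|\mathbb{S}|}\to\mathbb{R}^{|\mathbb{S}|}$ (jointly measurable in $(\omega,v)$). On the infinite product $(\Omega^\infty,\mathcal F^\infty,\mathcal P)$ with elements $\boldsymbol\omega=(\omega_j)_{j\ge0}$, whose coordinates are i.i.d. with law $P$, define $\widehat T_n^k(\boldsymbol\omega)v=\widehat T_n(\omega_{k-1})\cdots\widehat T_n(\omega_0)v$ and, for a deterministic seed $\hat v_n^0$ (with $\|\hat v_n^0\|\le\kappa^*$), $\hat v_n^k=\widehat T_n^k\hat v_n^0$. Fix a granularity $\epsilon_g>0$. Define $X_n^k=\lceil\|\hat v_n^k-v^*\|/\epsilon_g\rceil$, $N^*=\lceil2\kappa^*/\epsilon_g\rceil$ and $\eta^*=\min\{\eta\in\mathbb{N}:\lceil\alpha\eta+1\rceil<\eta\}=\lceil2/(1-\alpha)\rceil$. Fix $n$ and write $p_n=p_n(\epsilon_g)$, where $0<p_n<1$ and $\eta^*\le N^*$ (so that the following chain is defined). $\{Y_n^k\}_{k\ge0}$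 is the Markov chain on $\mathcal X=\{\eta^*,\eta^*+1,\dots,N^*\}$ (defined on its own canonical trajectory space with measure $\mathcal Q$) with transitions $Y_n^{k+1}=\max\{Y_n^k-1,\eta^*\}$ with probability $p_n$ and $Y_n^{k+1}=N^*$ with probability $1-p_n$. For real random variables $X,Y$ (possibly on different probability spaces), $X\le_{st}Y$ means $\mathbb{E}[f(X)]\le\mathbb{E}[f(Y)]$ for all increasing $f:\mathbb{R}\to\mathbb{R}$; equivalently $\Pr\{X\ge\theta\}\le\Pr\{Y\ge\theta\}$ for all $\theta$. *)

theory Defs
  imports "HOL-Probability.Probability"
begin

text \<open>
  The sup norm on \<open>real ^ 's\<close> is the library's \<^const>\<open>infnorm\<close> (see \<open>infnorm_cart\<close>).
\<close>

definition Omega :: "(nat \<Rightarrow> real) measure" where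
  "Omega = PiM UNIV (\<lambda>_. restrict_space lborel {0..1})"

definition Omega_seq :: "(nat \<Rightarrow> nat \<Rightarrow> real) measure" where
  "Omega_seq = PiM UNIV (\<lambda>_. Omega)"

text \<open>
  A random operator is a map \<open>A\<close> where \<open>A \<omega> v\<close> is the value of the realisation \<open>A \<omega>\<close> at \<open>v\<close>;
  \<open>rand_iter A k \<omega> v = A (\<omega> (k - 1)) (\<dots> (A (\<omega> 0) v))\<close>.
\<close>

primrec rand_iter :: "('w \<Rightarrow> 'v \<Rightarrow> 'v) \<Rightarrow> nat \<Rightarrow> (nat \<Rightarrow> 'w) \<Rightarrow> 'v \<Rightarrow> 'v" where
  "rand_iter A 0 \<omega> v = v"
| "rand_iter A (Suc k) \<omega> v = A (\<omega> k) (rand_iter A k \<omega> v)"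

definition err :: "real \<Rightarrow> real ^ 's \<Rightarrow> ('w \<Rightarrow> real ^ 's \<Rightarrow> real ^ 's) \<Rightarrow> real ^ 's
    \<Rightarrow> nat \<Rightarrow> (nat \<Rightarrow> 'w) \<Rightarrow> int" where
  "err \<epsilon> vstar A v0 k \<omega> = \<lceil>infnorm (rand_iter A k \<omega> v0 - vstar) / \<epsilon>\<rceil>"

definition Nstar :: "real \<Rightarrow> real \<Rightarrow> int" where
  "Nstar \<kappa> \<epsilon> = \<lceil>2 * \<kappa> / \<epsilon>\<rceil>"

definition eta_star :: "real \<Rightarrow> int" where
  "eta_star \<alpha> = int (LEAST \<eta>::nat. \<lceil>\<alpha> * real \<eta> + 1\<rceil> < int \<eta>)"

lemma eta_star_eq:
  assumes "0 < \<alpha>" "\<alpha> < 1"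
  shows "eta_star \<alpha> = \<lceil>2 / (1 - \<alpha>)\<rceil>"
proof -
  have *: "\<lceil>\<alpha> * real \<eta> + 1\<rceil> < int \<eta> \<longleftrightarrow> \<lceil>2 / (1 - \<alpha>)\<rceil> \<le> int \<eta>" for \<eta> :: nat
  proof -
    have "\<lceil>\<alpha> * real \<eta> + 1\<rceil> < int \<eta> \<longleftrightarrow> \<alpha> * real \<eta> + 1 \<le> real \<eta> - 1" by linarith
    also have "\<dots> \<longleftrightarrow> 2 / (1 - \<alpha>) \<le> real \<eta>" using assms by (simp add: field_simps)
    also have "\<dots> \<longleftrightarrow> \<lceil>2 / (1 - \<alpha>)\<rceil> \<le> int \<eta>" by (simp add: ceiling_le_iff)
    finally show ?thesis .
  qed
  have "0 < 2 / (1 - \<alpha>)" using assms by simp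
  hence pos: "0 < \<lceil>2 / (1 - \<alpha>)\<rceil>" by simp
  have "(LEAST \<eta>::nat. \<lceil>\<alpha> * real \<eta> + 1\<rceil> < int \<eta>) = nat \<lceil>2 / (1 - \<alpha>)\<rceil>"
    unfolding * by (rule Least_equality) (use pos in linarith)+
  hence "eta_star \<alpha> = int (nat \<lceil>2 / (1 - \<alpha>)\<rceil>)" unfolding eta_star_def by (rule arg_cong)
  with pos show ?thesis by linarith
qed

definition Y_trans :: "real \<Rightarrow> int \<Rightarrow> int \<Rightarrow> int \<Rightarrow> int pmf" where
  "Y_trans p \<eta> N y = map_pmf (\<lambda>b. if b then max (y - 1) \<eta> else N) (bernoulli_pmf p)"

text \<open>
  \<open>Q\<close> is the law, on the canonical trajectory space over the countable state space \<open>S\<close>, of a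
  time-homogeneous Markov chain with transition probabilities \<open>pmf (K a) b\<close>; the coordinates
  are the states of the chain, and the law of the initial state is left open.
\<close>

definition markov_chain_law :: "'a set \<Rightarrow> ('a \<Rightarrow> 'a pmf) \<Rightarrow> (nat \<Rightarrow> 'a) measure \<Rightarrow> bool" where
  "markov_chain_law S K Q \<longleftrightarrow>
     prob_space Q \<and> sets Q = sets (PiM UNIV (\<lambda>_. count_space S)) \<and>
     (\<forall>k. \<forall>a \<in> {..k} \<rightarrow> S. \<forall>b\<in>S. \<P>(y in Q. \<forall>i\<le>k. y i = a i) > 0 \<longrightarrow>
        \<P>(y in Q. y (Suc k) = b \<bar> \<forall>i\<le>k. y i = a i) = pmf (K (a k)) b)"

lemma markov_chain_law_Y_exists:
  assumes p: "0 \<le> p" "p \<le> 1" and x0: "x0 \<in> {\<eta>..N}"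
  shows "\<exists>Q. markov_chain_law {\<eta>..N} (Y_trans p \<eta> N) Q \<and> (AE y in Q. y 0 = x0)"
proof -
  define S where "S = {\<eta>..N}"
  define B :: "nat \<Rightarrow> bool measure" where "B = (\<lambda>_. measure_pmf (bernoulli_pmf p))"
  define M where "M = PiM UNIV B"
  define upd where "upd = (\<lambda>(b::bool) y. if b then max (y - 1) \<eta> else N)"
  define Z :: "nat \<Rightarrow> (nat \<Rightarrow> bool) \<Rightarrow> int" where
    "Z = (\<lambda>k w. rec_nat x0 (\<lambda>i. upd (w i)) k)"
  define C :: "(nat \<Rightarrow> int) measure" where "C = PiM UNIV (\<lambda>_. count_space S)"
  define Q where "Q = distr M C (\<lambda>w k. Z k w)"
  have Z0 [simp]: "Z 0 w = x0" and ZSuc [simp]: "Z (Suc k) w = upd (w k) (Z k w)" for k w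
    by (simp_all add: Z_def)
  have upd_S: "y \<in> S \<Longrightarrow> upd b y \<in> S" for b y using x0 by (auto simp: upd_def S_def)
  have Z_S: "Z k w \<in> S" for k w by (induction k) (use x0 upd_S in \<open>auto simp: S_def\<close>)
  interpret M: prob_space M
    unfolding M_def B_def by (intro prob_space_PiM prob_space_measure_pmf)
  have setsB [simp]: "sets (B i) = UNIV" for i by (simp add: B_def)
  have spM [simp]: "space M = UNIV" by (simp add: M_def B_def space_PiM)
  have comp: "(\<lambda>w. w i) \<in> M \<rightarrow>\<^sub>M count_space UNIV" for i
    unfolding M_def B_def by (rule measurable_compose[OF measurable_component_singleton]) auto
  have Zm: "Z k \<in> M \<rightarrow>\<^sub>M count_space UNIV" for k
  proof (induction k)
    case 0 show ?case by (simp add: Z_def)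
  next
    case (Suc k)
    have "(\<lambda>w. case (w k, Z k w) of (b, y) \<Rightarrow> upd b y) \<in> M \<rightarrow>\<^sub>M count_space UNIV"
      by (rule measurable_compose[OF measurable_Pair[OF comp Suc]])
         (simp add: pair_measure_countable)
    thus ?case by (simp add: fun_eq_iff cong: measurable_cong)
  qed
  have ZmS: "Z k \<in> M \<rightarrow>\<^sub>M count_space S" for k
    using Zm[of k] Z_S by (auto simp: measurable_def)
  have ZC: "(\<lambda>w k. Z k w) \<in> M \<rightarrow>\<^sub>M C"
    unfolding C_def using Z_S by (intro measurable_PiM_single') (auto intro: ZmS simp: PiE_def)
  have prQ: "prob_space Q" unfolding Q_def by (rule M.prob_space_distr[OF ZC])
  have coordC: "(\<lambda>y. y i) \<in> C \<rightarrow>\<^sub>M count_space S" for i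
    unfolding C_def by (rule measurable_component_singleton) simp
  have eqC: "{y \<in> space C. y i = a} \<in> sets C" for i a
  proof -
    have "{y \<in> space C. y i = a} = (\<lambda>y. y i) -` ({a} \<inter> S) \<inter> space C"
      using measurable_space[OF coordC] by auto
    thus ?thesis using measurable_sets[OF coordC, of "{a} \<inter> S" i] by simp
  qed
  have histC: "{y \<in> space C. \<forall>i\<le>k. y i = a i} \<in> sets C" for k a
    using sets.sets_Collect_finite_All'[of "{..k}" C "\<lambda>i y. y i = a i"] eqC
    by auto
  have prob_Q: "\<P>(y in Q. P y) = M.prob {w. P (\<lambda>k. Z k w)}"
    if "{y \<in> space C. P y} \<in> sets C" for P
    using that measurable_space[OF ZC]
    by (simp add: Q_def measure_distr[OF ZC])
  have indep: "M.indep_vars B (\<lambda>i w. w i) UNIV"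
  proof -
    have "distr M (PiM UNIV B) (\<lambda>w. \<lambda>i\<in>UNIV. w i) = M"
      by (simp add: M_def restrict_def)
    moreover have "distr M (B i) (\<lambda>w. w i) = B i" for i
      unfolding M_def B_def by (intro distr_PiM_component prob_space_measure_pmf) simp
    moreover have "(\<lambda>w. w i) \<in> M \<rightarrow>\<^sub>M B i" for i unfolding M_def by simp
    ultimately show ?thesis
      by (subst M.indep_vars_iff_distr_eq_PiM) (simp_all add: M_def)
  qed
  have step: "\<P>(y in Q. y (Suc k) = b \<and> (\<forall>i\<le>k. y i = a i)) =
      pmf (Y_trans p \<eta> N (a k)) b * \<P>(y in Q. \<forall>i\<le>k. y i = a i)" for k a b
  proof -
    define F where "F = {w \<in> space (PiM {..<k} B). \<forall>i\<le>k. Z i w = a i}"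
    define G where "G = {w \<in> space (PiM {k} B). upd (w k) (a k) = b}"
    have discr: "A \<in> sets (PiM I B)" if "A \<subseteq> space (PiM I B)" "finite I" for A I
    proof -
      have "sets (PiM I B) = sets (PiM I (\<lambda>_. count_space UNIV))"
        by (intro sets_PiM_cong) (auto simp: B_def)
      also have "\<dots> = sets (count_space (PiE I (\<lambda>_. UNIV)))"
        using that(2) by (subst count_space_PiM_finite) auto
      finally show ?thesis using that(1) by (auto simp: space_PiM B_def)
    qed
    have Zr: "Z i (restrict w {..<k}) = Z i w" if "i \<le> k" for i w
      using that by (induction i) auto
    have preF: "(\<lambda>w. restrict w {..<k}) -` F = {w. \<forall>i\<le>k. Z i w = a i}"
      by (auto simp: F_def Zr space_PiM B_def)
    have preG: "(\<lambda>w. restrict w {k}) -` G = {w. upd (w k) (a k) = b}"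
      by (auto simp: G_def space_PiM B_def)
    have "M.indep_var (PiM {..<k} B) (\<lambda>w. restrict w {..<k}) (PiM {k} B) (\<lambda>w. restrict w {k})"
      using M.indep_var_restrict[OF indep, of "{..<k}" "{k}"] by simp
    moreover have "F \<in> sets (PiM {..<k} B)" "G \<in> sets (PiM {k} B)"
      by (rule discr; auto simp: F_def G_def)+
    ultimately have "M.prob ((\<lambda>w. (restrict w {..<k}, restrict w {k})) -` (F \<times> G) \<inter> space M) =
        M.prob ((\<lambda>w. restrict w {..<k}) -` F \<inter> space M) *
        M.prob ((\<lambda>w. restrict w {k}) -` G \<inter> space M)"
      by (rule M.indep_varD)
    moreover have "(\<lambda>w. (restrict w {..<k}, restrict w {k})) -` (F \<times> G) =
        (\<lambda>w. restrict w {..<k}) -` F \<inter> (\<lambda>w. restrict w {k}) -` G" by blast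
    ultimately have "M.prob {w. (\<forall>i\<le>k. Z i w = a i) \<and> upd (w k) (a k) = b} =
        M.prob {w. \<forall>i\<le>k. Z i w = a i} * M.prob {w. upd (w k) (a k) = b}"
      by (simp only: preF preG spM Int_UNIV_right Collect_conj_eq)
    moreover have "{w. (\<forall>i\<le>k. Z i w = a i) \<and> upd (w k) (a k) = b} =
        {w. Z (Suc k) w = b \<and> (\<forall>i\<le>k. Z i w = a i)}" by auto
    moreover have "M.prob {w. upd (w k) (a k) = b} = pmf (Y_trans p \<eta> N (a k)) b"
    proof -
      have "measure_pmf (bernoulli_pmf p) = distr M (B k) (\<lambda>w. w k)"
        unfolding M_def B_def by (intro distr_PiM_component[symmetric] prob_space_measure_pmf) simp
      hence "measure (bernoulli_pmf p) {c. upd c (a k) = b} = M.prob {w. upd (w k) (a k) = b}"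
        using measure_distr[of "\<lambda>w. w k" M "B k" "{c. upd c (a k) = b}"] comp[of k]
        by (simp add: vimage_def B_def)
      thus ?thesis by (simp add: Y_trans_def pmf_map upd_def vimage_def)
    qed
    moreover have "{y \<in> space C. y (Suc k) = b \<and> (\<forall>i\<le>k. y i = a i)} \<in> sets C"
      using eqC[of "Suc k" b] histC[of k a] by (intro sets.sets_Collect_conj)
    ultimately show ?thesis by (simp only: prob_Q histC mult.commute)
  qed
  have "markov_chain_law S (Y_trans p \<eta> N) Q"
    unfolding markov_chain_law_def
    using prQ step by (auto simp: Q_def C_def cond_prob_def)
  moreover have "AE y in Q. y 0 = x0"
    unfolding Q_def by (subst AE_distr_iff[OF ZC eqC]) simp
  ultimately show ?thesis unfolding S_def by blast
qed

text \<open>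
  The stochastic order of real random variables on possibly different probability spaces. The
  Bochner integral of a non-integrable function is 0, so the comparison ranges over those
  increasing \<open>f\<close> for which both expectations exist.
\<close>

definition stoch_le :: "'a measure \<Rightarrow> ('a \<Rightarrow> real) \<Rightarrow> 'b measure \<Rightarrow> ('b \<Rightarrow> real) \<Rightarrow> bool" where
  "stoch_le M X N Y \<longleftrightarrow>
     X \<in> borel_measurable M \<and> Y \<in> borel_measurable N \<and>
     (\<forall>f :: real \<Rightarrow> real. mono f \<longrightarrow> integrable M (\<lambda>x. f (X x)) \<longrightarrow> integrable N (\<lambda>y. f (Y y)) \<longrightarrow>
        (\<integral>x. f (X x) \<partial>M) \<le> (\<integral>y. f (Y y) \<partial>N))"

end

theory Submission
  imports Defs
begin

text \<open>
  The chain \<open>Y\<close> is the pessimistic caricature of the error process \<open>X\<close>. Whatever the current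
  iterate \<open>v\<close> is, the next operator is accurate to within \<open>\<epsilon>\<close> at \<open>v\<close> with probability at least
  \<open>p\<close>. In that case the contraction bounds the new error by \<open>\<alpha> \<parallel>v - v\<^sup>*\<parallel> + \<epsilon>\<close>; in units of \<open>\<epsilon>\<close> the
  map \<open>x \<mapsto> \<lceil>\<alpha> x + 1\<rceil>\<close> lowers every \<open>x \<ge> \<eta>\<^sup>*\<close> by at least one and keeps every smaller \<open>x\<close> below
  \<open>\<eta>\<^sup>*\<close>, so the error moves to at most \<open>max (x - 1) \<eta>\<^sup>*\<close> (\<open>ceiling_contraction_step\<close>). Otherwise it
  is still at most \<open>N\<^sup>*\<close>, because all iterates and the fixed point lie in the ball of radius \<open>\<kappa>\<close>.
  Hence, for every increasing \<open>f\<close> and with \<open>g x = f (max (x - 1) \<eta>\<^sup>*)\<close>,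
  \<open>E f(X\<^sub>k\<^sub>+\<^sub>1) \<le> p E g(X\<^sub>k) + (1 - p) f(N\<^sup>*)\<close> (\<open>expectation_ceiling_error_step\<close>), whereas \<open>Y\<close>
  satisfies this relation with equality (\<open>markov_chain_law_expectation_Suc\<close>,
  \<open>expectation_Y_trans\<close>).

  Since \<open>g\<close> is again increasing, the inequality \<open>E f(X\<^sub>k) \<le> E f(Y\<^sub>k)\<close>, claimed for all increasing
  \<open>f\<close> at once, follows by induction on \<open>k\<close>. All
  integrals exist: up to null sets both processes stay between \<open>0\<close> and \<open>N\<^sup>*\<close>, where a monotone
  function is bounded. The one use of independence is that the operator applied at time \<open>k\<close> is
  independent of the iterate it is applied to, which turns the expectation at time \<open>k + 1\<close> into
  an iterated integral (\<open>integral_fresh_coordinate\<close>).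
\<close>

section \<open>The deterministic contraction step\<close>

text \<open>
  The threshold \<open>\<eta>\<^sup>*\<close> is the first integer with \<open>\<alpha> \<eta> + 1 \<le> \<eta> - 1\<close>. As \<open>\<alpha> < 1\<close>, the inequality
  \<open>\<alpha> m + 1 \<le> m - 1\<close> persists for all \<open>m\<close> above it; below it, \<open>\<alpha> m + 1\<close> is at most its value at
  \<open>\<eta>\<^sup>*\<close>.
\<close>

lemma ceiling_contraction_step:
  fixes \<alpha> \<epsilon> d d' :: real
  assumes \<alpha>: "0 < \<alpha>" "\<alpha> < 1" and \<epsilon>: "0 < \<epsilon>" and d': "d' \<le> \<alpha> * d + \<epsilon>"
  shows "\<lceil>d' / \<epsilon>\<rceil> \<le> max (\<lceil>d / \<epsilon>\<rceil> - 1) (eta_star \<alpha>)"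
proof -
  define m where "m = \<lceil>d / \<epsilon>\<rceil>"
  define \<eta> where "\<eta> = eta_star \<alpha>"
  have "2 / (1 - \<alpha>) \<le> of_int \<eta>"
    unfolding \<eta>_def eta_star_eq[OF \<alpha>] by (rule le_of_int_ceiling)
  hence \<eta>: "\<alpha> * of_int \<eta> + 1 \<le> of_int \<eta> - 1" using \<alpha> by (simp add: field_simps)
  have "d' / \<epsilon> \<le> \<alpha> * (d / \<epsilon>) + 1" using d' \<epsilon> by (simp add: field_simps)
  also have "d / \<epsilon> \<le> of_int m" unfolding m_def by (rule le_of_int_ceiling)
  finally have step: "d' / \<epsilon> \<le> \<alpha> * of_int m + 1" using \<alpha> by simp
  show ?thesis
  proof (cases "\<eta> \<le> m")
    case True
    have "(1 - \<alpha>) * of_int \<eta> \<le> (1 - \<alpha>) * of_int m" using True \<alpha> by simp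
    with \<eta> have "\<alpha> * of_int m + 1 \<le> of_int (m - 1)" by (simp add: algebra_simps)
    with step have "d' / \<epsilon> \<le> of_int (m - 1)" by (rule order_trans)
    hence "\<lceil>d' / \<epsilon>\<rceil> \<le> m - 1" by (simp only: ceiling_le_iff)
    thus ?thesis unfolding m_def by simp
  next
    case False
    hence "\<alpha> * of_int m \<le> \<alpha> * of_int \<eta>" using \<alpha> by simp
    with step \<eta> have "\<lceil>d' / \<epsilon>\<rceil> \<le> \<eta>" by (simp add: ceiling_le_iff)
    thus ?thesis unfolding \<eta>_def by simp
  qed
qed

lemma ceiling_error_le_Nstar:
  fixes v w :: "real ^ 's"
  assumes "infnorm v \<le> \<kappa>" "infnorm w \<le> \<kappa>" "0 < \<epsilon>"
  shows "\<lceil>infnorm (v - w) / \<epsilon>\<rceil> \<le> Nstar \<kappa> \<epsilon>"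
proof -
  have "infnorm (v - w) \<le> infnorm v + infnorm w"
    using infnorm_triangle[of v "- w"] by (simp add: infnorm_neg)
  hence "infnorm (v - w) / \<epsilon> \<le> 2 * \<kappa> / \<epsilon>" using assms by (intro divide_right_mono) auto
  thus ?thesis unfolding Nstar_def by (rule ceiling_mono)
qed

lemma ceiling_error_nonneg: "0 < \<epsilon> \<Longrightarrow> 0 \<le> \<lceil>infnorm (v - w) / \<epsilon>\<rceil>"
proof -
  assume "0 < \<epsilon>"
  hence "0 \<le> infnorm (v - w) / \<epsilon>" by (simp add: infnorm_pos_le)
  thus ?thesis by linarith
qed

lemma borel_measurable_infnorm [measurable]:
  "(infnorm :: 'a::euclidean_space \<Rightarrow> real) \<in> borel_measurable borel"
  by (intro borel_measurable_continuous_onI continuous_intros)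

lemma measurable_ceiling_error:
  "(\<lambda>v::real ^ 's. \<lceil>infnorm (v - w) / \<epsilon>\<rceil>) \<in> borel \<rightarrow>\<^sub>M count_space UNIV"
  by measurable

lemma (in prob_space) expectation_le_two_values:
  fixes Z :: "'a \<Rightarrow> real"
  assumes int: "integrable M Z" and ab: "a \<le> b"
    and G: "G \<in> events" "p \<le> prob G"
    and Z: "\<And>x. x \<in> G \<Longrightarrow> Z x \<le> a" "\<And>x. Z x \<le> b"
  shows "expectation Z \<le> p * a + (1 - p) * b"
proof -
  have "expectation Z \<le> expectation (\<lambda>x. b - (b - a) * indicator G x)"
    using int G Z
    by (intro integral_mono Bochner_Integration.integrable_diff integrable_const
        integrable_mult_right integrable_real_indicator) (auto simp: indicator_def emeasure_eq_measure)
  also have "\<dots> = b - (b - a) * prob G"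
    using G by (subst Bochner_Integration.integral_diff)
      (auto simp: prob_space emeasure_eq_measure intro!: integrable_real_indicator)
  also have "\<dots> \<le> b - (b - a) * p" using G ab by (intro diff_left_mono mult_left_mono) auto
  finally show ?thesis by (simp add: algebra_simps)
qed

section \<open>The error process of the random iteration\<close>

text \<open>
  Splicing two independent sequences at position \<open>k\<close> gives a sequence with the original law.
  Past and present are then functions of different factors of a product measure, so that the
  theorem of Fubini expresses their independence.
\<close>

lemma (in sequence_space) integral_fresh_coordinate:
  fixes \<phi> :: "'a \<times> 'b \<Rightarrow> real"
  assumes \<phi> [measurable]: "\<phi> \<in> borel_measurable (M \<Otimes>\<^sub>M N)"
    and V [measurable]: "V \<in> S \<rightarrow>\<^sub>M N"
    and past: "\<And>\<omega> \<omega>'. V (comb_seq k \<omega> \<omega>') = V \<omega>"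
    and bound: "\<And>z. \<bar>\<phi> z\<bar> \<le> B"
  shows "(\<integral>\<omega>. \<phi> (\<omega> k, V \<omega>) \<partial>S) = (\<integral>\<omega>. (\<integral>x. \<phi> (x, V \<omega>) \<partial>M) \<partial>S)"
proof -
  have prob_M: "prob_space M" by unfold_locales
  have prob_S: "prob_space S" by (intro prob_space_PiM prob_M)
  interpret SS: pair_prob_space S S
    using prob_S
    by (simp add: pair_prob_space_def pair_sigma_finite_def prob_space_imp_sigma_finite)
  have "(\<integral>\<omega>. \<phi> (\<omega> k, V \<omega>) \<partial>S) =
      (\<integral>\<omega>. \<phi> (\<omega> k, V \<omega>) \<partial>distr (S \<Otimes>\<^sub>M S) S (\<lambda>(\<omega>, \<omega>'). comb_seq k \<omega> \<omega>'))"
    by (simp add: PiM_comb_seq)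
  also have "\<dots> = (\<integral>z. \<phi> (snd z 0, V (fst z)) \<partial>(S \<Otimes>\<^sub>M S))"
    by (subst integral_distr) (auto simp: case_prod_beta past comb_seq_def)
  also have "\<dots> = (\<integral>\<omega>. (\<integral>\<omega>'. \<phi> (\<omega>' 0, V \<omega>) \<partial>S) \<partial>S)"
    using SS.integral_fst'[of "\<lambda>z. \<phi> (snd z 0, V (fst z))"] bound
    by (simp add: SS.integrable_const_bound[where B = B])
  also have "(\<integral>\<omega>'. \<phi> (\<omega>' 0, V \<omega>) \<partial>S) = (\<integral>x. \<phi> (x, V \<omega>) \<partial>M)" if "\<omega> \<in> space S" for \<omega>
  proof -
    have [measurable]: "(\<lambda>x. \<phi> (x, V \<omega>)) \<in> borel_measurable M"
      using measurable_space[OF V that] by measurable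
    have "(\<integral>x. \<phi> (x, V \<omega>) \<partial>M) = (\<integral>x. \<phi> (x, V \<omega>) \<partial>distr S M (\<lambda>\<omega>'. \<omega>' 0))"
      by (subst distr_PiM_component) (auto intro: prob_M)
    also have "\<dots> = (\<integral>\<omega>'. \<phi> (\<omega>' 0, V \<omega>) \<partial>S)" by (subst integral_distr) auto
    finally show ?thesis ..
  qed
  hence "(\<integral>\<omega>. (\<integral>\<omega>'. \<phi> (\<omega>' 0, V \<omega>) \<partial>S) \<partial>S) = (\<integral>\<omega>. (\<integral>x. \<phi> (x, V \<omega>) \<partial>M) \<partial>S)"
    by (intro Bochner_Integration.integral_cong) auto
  finally show ?thesis .
qed

lemma rand_iter_comb_seq:
  "i \<le> k \<Longrightarrow> rand_iter A i (comb_seq k \<omega> \<omega>') v = rand_iter A i \<omega> v"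
  by (induction i) (auto simp: comb_seq_less)

lemma measurable_rand_iter:
  assumes A: "(\<lambda>(x, v). A x v) \<in> (M \<Otimes>\<^sub>M borel) \<rightarrow>\<^sub>M (borel :: (real ^ 's) measure)"
  shows "(\<lambda>\<omega>. rand_iter A k \<omega> v) \<in> PiM UNIV (\<lambda>_. M) \<rightarrow>\<^sub>M borel"
proof (induction k)
  case (Suc k)
  have "(\<lambda>\<omega>. (\<omega> k, rand_iter A k \<omega> v)) \<in> PiM UNIV (\<lambda>_. M) \<rightarrow>\<^sub>M M \<Otimes>\<^sub>M borel"
    using Suc by measurable
  from measurable_compose[OF this A] show ?case by simp
qed simp

lemma measurable_err:
  assumes "(\<lambda>(x, v). A x v) \<in> (M \<Otimes>\<^sub>M borel) \<rightarrow>\<^sub>M (borel :: (real ^ 's) measure)"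
  shows "err \<epsilon> vstar A v0 k \<in> PiM UNIV (\<lambda>_. M) \<rightarrow>\<^sub>M count_space UNIV"
  using measurable_compose[OF measurable_rand_iter[OF assms] measurable_ceiling_error]
  unfolding err_def .

lemma mono_bounded_between:
  fixes f :: "int \<Rightarrow> real"
  assumes "mono f" "a \<le> i" "i \<le> b"
  shows "\<bar>f i\<bar> \<le> \<bar>f a\<bar> + \<bar>f b\<bar>"
  using monoD[OF assms(1,2)] monoD[OF assms(1,3)] by linarith

lemma (in prob_space) integrable_mono_between:
  fixes f :: "int \<Rightarrow> real"
  assumes "mono f" "X \<in> M \<rightarrow>\<^sub>M count_space UNIV" "AE x in M. a \<le> X x \<and> X x \<le> b"
  shows "integrable M (\<lambda>x. f (X x))"
proof (rule integrable_const_bound)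
  show "AE x in M. norm (f (X x)) \<le> \<bar>f a\<bar> + \<bar>f b\<bar>"
    using assms(3) by eventually_elim (use mono_bounded_between[OF assms(1)] in auto)
  show "(\<lambda>x. f (X x)) \<in> borel_measurable M"
    using measurable_compose[OF assms(2), of f borel] by simp
qed

text \<open>
  The truncation at \<open>N\<^sup>*\<close> on the right changes the integrand only on a null set. It bounds
  the function of the error state everywhere, also where an exceptional realisation carries
  the iterate out of the ball.
\<close>

lemma (in sequence_space) expectation_ceiling_error_step:
  fixes A :: "'a \<Rightarrow> real ^ 's \<Rightarrow> real ^ 's" and T :: "real ^ 's \<Rightarrow> real ^ 's"
    and f :: "int \<Rightarrow> real"
  assumes \<alpha>: "0 < \<alpha>" "\<alpha> < 1" and \<epsilon>: "0 < \<epsilon>" and \<eta>N: "eta_star \<alpha> \<le> Nstar \<kappa> \<epsilon>"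
    and A: "(\<lambda>(x, v). A x v) \<in> (M \<Otimes>\<^sub>M borel) \<rightarrow>\<^sub>M borel"
    and vstar: "infnorm vstar \<le> \<kappa>"
    and bounded: "\<And>k. AE \<omega> in S. infnorm (rand_iter A k \<omega> v0) \<le> \<kappa>"
    and contr: "\<And>v. infnorm (T v - vstar) \<le> \<alpha> * infnorm (v - vstar)"
    and accurate: "\<And>v. infnorm v \<le> \<kappa> \<Longrightarrow> p \<le> \<P>(x in M. infnorm (T v - A x v) < \<epsilon>)"
    and f: "mono f"
  shows "(\<integral>\<omega>. f (err \<epsilon> vstar A v0 (Suc k) \<omega>) \<partial>S) \<le>
    p * (\<integral>\<omega>. f (min (Nstar \<kappa> \<epsilon>) (max (err \<epsilon> vstar A v0 k \<omega> - 1) (eta_star \<alpha>))) \<partial>S)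
      + (1 - p) * f (Nstar \<kappa> \<epsilon>)"
proof -
  define N where "N = Nstar \<kappa> \<epsilon>"
  define \<eta> where "\<eta> = eta_star \<alpha>"
  define V where "V = (\<lambda>\<omega>. rand_iter A k \<omega> v0)"
  define X where "X = err \<epsilon> vstar A v0 k"
  define c where "c = (\<lambda>v. \<lceil>infnorm (v - vstar) / \<epsilon>\<rceil>)"
  \<comment> \<open>The truncated new error inherits joint measurability in noise and iterate from \<open>A\<close>, as
    Fubini demands. The accuracy event, which involves \<open>T\<close>, enters for one fixed iterate at a time.\<close>
  define \<phi> where "\<phi> = (\<lambda>(x, v). f (min N (c (A x v))))"
  define g where "g = (\<lambda>i. f (min N (max (i - 1) \<eta>)))"
  have c0: "0 \<le> c v" for v unfolding c_def by (rule ceiling_error_nonneg[OF \<epsilon>])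
  have "0 \<le> infnorm vstar" by (rule infnorm_pos_le)
  hence "0 \<le> 2 * \<kappa> / \<epsilon>" using vstar \<epsilon> by simp
  hence N0: "0 \<le> N" unfolding N_def Nstar_def by linarith
  have V_m: "V \<in> S \<rightarrow>\<^sub>M borel" unfolding V_def by (rule measurable_rand_iter[OF A])
  have X_m: "X \<in> S \<rightarrow>\<^sub>M count_space UNIV" unfolding X_def by (rule measurable_err[OF A])
  have c_m: "c \<in> borel \<rightarrow>\<^sub>M count_space UNIV" unfolding c_def by (rule measurable_ceiling_error)
  have \<phi>_m: "\<phi> \<in> borel_measurable (M \<Otimes>\<^sub>M borel)"
  proof -
    have "(\<lambda>i. f (min N i)) \<in> count_space UNIV \<rightarrow>\<^sub>M borel" by simp
    from measurable_compose[OF measurable_compose[OF A c_m] this]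
    show ?thesis by (simp add: \<phi>_def case_prod_beta)
  qed
  have \<phi>_bound: "\<bar>\<phi> z\<bar> \<le> \<bar>f 0\<bar> + \<bar>f N\<bar>" for z
    unfolding \<phi>_def case_prod_beta using c0 N0 by (intro mono_bounded_between[OF f]) auto
  have g_bound: "\<bar>g i\<bar> \<le> \<bar>f \<eta>\<bar> + \<bar>f N\<bar>" for i
    unfolding g_def using \<eta>N by (intro mono_bounded_between[OF f]) (auto simp: \<eta>_def N_def)
  have g_int: "integrable S (\<lambda>\<omega>. g (X \<omega>))"
    using measurable_compose[OF X_m, of g borel] g_bound
    by (intro P.integrable_const_bound[where B = "\<bar>f \<eta>\<bar> + \<bar>f N\<bar>"]) auto
  have section_m: "(\<lambda>x. \<phi> (x, v)) \<in> borel_measurable M" for v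
    using measurable_compose[OF measurable_Pair[OF measurable_ident_sets[OF refl] measurable_const] \<phi>_m]
    by simp
  have section_int: "integrable M (\<lambda>x. \<phi> (x, v))" for v
    using \<phi>_bound section_m
    by (intro M.integrable_const_bound[where B = "\<bar>f 0\<bar> + \<bar>f N\<bar>"]) auto
  have inner: "(\<integral>x. \<phi> (x, v) \<partial>M) \<le> p * g (c v) + (1 - p) * f N" if v: "infnorm v \<le> \<kappa>" for v
  proof (rule M.expectation_le_two_values[OF section_int])
    let ?G = "{x \<in> space M. infnorm (T v - A x v) < \<epsilon>}"
    have [measurable]: "(\<lambda>x. A x v) \<in> M \<rightarrow>\<^sub>M borel"
      using measurable_compose[OF measurable_Pair[OF measurable_ident_sets[OF refl] measurable_const] A]
      by simp
    show "?G \<in> sets M" by measurable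
    show "p \<le> measure M ?G" by (rule accurate[OF v])
    show "g (c v) \<le> f N" unfolding g_def by (rule monoD[OF f]) simp
    show "\<phi> (x, v) \<le> f N" for x by (simp add: \<phi>_def monoD[OF f])
    fix x assume x: "x \<in> ?G"
    have "infnorm (A x v - vstar) \<le> infnorm (A x v - T v) + infnorm (T v - vstar)"
      using infnorm_triangle[of "A x v - T v" "T v - vstar"] by simp
    hence "infnorm (A x v - vstar) \<le> \<alpha> * infnorm (v - vstar) + \<epsilon>"
      using contr[of v] x infnorm_sub[of "A x v" "T v"] by simp
    from ceiling_contraction_step[OF \<alpha> \<epsilon> this]
    have "c (A x v) \<le> max (c v - 1) \<eta>" by (simp add: c_def \<eta>_def)
    thus "\<phi> (x, v) \<le> g (c v)" unfolding \<phi>_def g_def by (auto intro: monoD[OF f])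
  qed
  have "(\<integral>\<omega>. f (err \<epsilon> vstar A v0 (Suc k) \<omega>) \<partial>S) = (\<integral>\<omega>. \<phi> (\<omega> k, V \<omega>) \<partial>S)"
  proof (rule integral_cong_AE)
    show "(\<lambda>\<omega>. f (err \<epsilon> vstar A v0 (Suc k) \<omega>)) \<in> borel_measurable S"
      using measurable_compose[OF measurable_err[OF A], of f borel] by simp
    show "(\<lambda>\<omega>. \<phi> (\<omega> k, V \<omega>)) \<in> borel_measurable S"
      using V_m \<phi>_m by measurable
    show "AE \<omega> in S. f (err \<epsilon> vstar A v0 (Suc k) \<omega>) = \<phi> (\<omega> k, V \<omega>)"
      using bounded[of "Suc k"]
    proof eventually_elim
      case (elim \<omega>)
      from ceiling_error_le_Nstar[OF this vstar \<epsilon>]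
      show ?case by (simp add: err_def \<phi>_def V_def N_def c_def)
    qed
  qed
  also have "\<dots> = (\<integral>\<omega>. (\<integral>x. \<phi> (x, V \<omega>) \<partial>M) \<partial>S)"
    by (rule integral_fresh_coordinate[OF \<phi>_m V_m _ \<phi>_bound])
      (simp add: V_def rand_iter_comb_seq)
  also have "\<dots> \<le> (\<integral>\<omega>. p * g (X \<omega>) + (1 - p) * f N \<partial>S)"
  proof (rule integral_mono_AE)
    have "(\<lambda>v. \<integral>x. \<phi> (x, v) \<partial>M) \<in> borel_measurable borel"
      using \<phi>_m by measurable
    from measurable_compose[OF V_m this]
    show "integrable S (\<lambda>\<omega>. \<integral>x. \<phi> (x, V \<omega>) \<partial>M)"
    proof (rule P.integrable_const_bound[rotated])
      have "\<bar>\<integral>x. \<phi> (x, v) \<partial>M\<bar> \<le> (\<integral>x. \<bar>f 0\<bar> + \<bar>f N\<bar> \<partial>M)" for v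
        using \<phi>_bound section_int
        by (intro order_trans[OF integral_abs_bound] integral_mono integrable_abs) auto
      thus "AE \<omega> in S. norm (\<integral>x. \<phi> (x, V \<omega>) \<partial>M) \<le> \<bar>f 0\<bar> + \<bar>f N\<bar>"
        by (simp add: M.prob_space)
    qed
    show "integrable S (\<lambda>\<omega>. p * g (X \<omega>) + (1 - p) * f N)" using g_int by simp
    show "AE \<omega> in S. (\<integral>x. \<phi> (x, V \<omega>) \<partial>M) \<le> p * g (X \<omega>) + (1 - p) * f N"
      using bounded[of k]
    proof eventually_elim
      case (elim \<omega>)
      thus ?case using inner[of "V \<omega>"] by (simp add: V_def X_def err_def c_def)
    qed
  qed
  also have "\<dots> = p * (\<integral>\<omega>. g (X \<omega>) \<partial>S) + (1 - p) * f N"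
    using g_int by (simp add: P.prob_space)
  finally show ?thesis by (simp add: g_def X_def N_def \<eta>_def)
qed

section \<open>The dominating Markov chain\<close>

text \<open>
  The law of a Markov chain is given through its histories. For a finite state space these are
  finite in number, so both expectations are finite sums over histories and next states.
\<close>

lemma markov_chain_law_expectation_Suc:
  fixes g :: "'a \<Rightarrow> real"
  assumes law: "markov_chain_law S K Q" and S: "finite S"
    and K: "\<And>a. a \<in> S \<Longrightarrow> set_pmf (K a) \<subseteq> S"
  shows "(\<integral>y. g (y (Suc k)) \<partial>Q) = (\<integral>y. measure_pmf.expectation (K (y k)) g \<partial>Q)"
proof -
  interpret Q: prob_space Q using law by (simp add: markov_chain_law_def)
  have sets_Q: "sets Q = sets (PiM UNIV (\<lambda>_. count_space S))"
    using law by (simp add: markov_chain_law_def)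
  have space_Q: "y \<in> space Q \<Longrightarrow> y i \<in> S" for y i
    using sets_eq_imp_space_eq[OF sets_Q] by (auto simp: space_PiM PiE_def)
  have coord [measurable]: "(\<lambda>y. y i) \<in> Q \<rightarrow>\<^sub>M count_space S" for i
    by (subst measurable_cong_sets[OF sets_Q refl]) simp
  define H where "H = PiE {..k} (\<lambda>_. S)"
  define E where "E = (\<lambda>a. {y \<in> space Q. \<forall>i\<le>k. y i = a i})"
  define F where "F = (\<lambda>a b. {y \<in> space Q. y (Suc k) = b \<and> (\<forall>i\<le>k. y i = a i)})"
  have fin_H: "finite H" unfolding H_def using S by (intro finite_PiE) auto
  have a_S: "a \<in> H \<Longrightarrow> i \<le> k \<Longrightarrow> a i \<in> S" for a i unfolding H_def by auto
  have eq_m: "{y \<in> space Q. y i = a} \<in> sets Q" for i a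
  proof -
    have "{y \<in> space Q. y i = a} = (\<lambda>y. y i) -` ({a} \<inter> S) \<inter> space Q"
      using space_Q by auto
    thus ?thesis using measurable_sets[OF coord, of "{a} \<inter> S" i] by simp
  qed
  have E_m: "E a \<in> sets Q" for a
    using sets.sets_Collect_finite_All'[of "{..k}" Q "\<lambda>i y. y i = a i"] eq_m
    by (auto simp: E_def)
  have F_m: "F a b \<in> sets Q" for a b
    using sets.sets_Collect_conj[OF eq_m[of "Suc k" b] E_m[of a, unfolded E_def]]
    by (simp add: F_def)
  have prob_F: "Q.prob (F a b) = pmf (K (a k)) b * Q.prob (E a)" if "a \<in> H" "b \<in> S" for a b
  proof (cases "Q.prob (E a) > 0")
    case True
    have "a \<in> {..k} \<rightarrow> S" using that by (auto simp: H_def)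
    hence "\<P>(y in Q. y (Suc k) = b \<bar> \<forall>i\<le>k. y i = a i) = pmf (K (a k)) b"
      using law that True by (simp add: markov_chain_law_def E_def)
    with True show ?thesis by (simp add: cond_prob_def E_def F_def field_simps)
  next
    case False
    hence "Q.prob (E a) = 0" using measure_nonneg[of Q "E a"] by linarith
    moreover have "Q.prob (F a b) \<le> Q.prob (E a)"
      by (rule Q.finite_measure_mono[OF _ E_m]) (auto simp: E_def F_def)
    ultimately show ?thesis using measure_nonneg[of Q "F a b"] by simp
  qed
  have E_iff: "y \<in> E a \<longleftrightarrow> a = restrict y {..k}" if "y \<in> space Q" "a \<in> H" for y a
    using that by (auto simp: E_def H_def PiE_def extensional_def fun_eq_iff)
  have H_mem: "restrict y {..k} \<in> H" if "y \<in> space Q" for y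
    using space_Q[OF that] by (auto simp: H_def)
  have split_H: "(\<Sum>a\<in>H. indicator (E a) y * h a) = h (restrict y {..k})"
    if y: "y \<in> space Q" for y and h :: "(nat \<Rightarrow> 'a) \<Rightarrow> real"
  proof -
    have "(\<Sum>a\<in>H. indicator (E a) y * h a) = (\<Sum>a\<in>H. if a = restrict y {..k} then h a else 0)"
      by (rule sum.cong) (auto simp: E_iff[OF y] indicator_def)
    also have "\<dots> = h (restrict y {..k})"
      using H_mem[OF y] fin_H by simp
    finally show ?thesis .
  qed
  have int_E: "integrable Q (\<lambda>y. indicator (E a) y * r)"
    and int_F: "integrable Q (\<lambda>y. indicator (F a b) y * r)" for a b and r :: real
    using E_m F_m by (auto simp: Q.emeasure_eq_measure)
  have "(\<integral>y. g (y (Suc k)) \<partial>Q) = (\<integral>y. (\<Sum>a\<in>H. \<Sum>b\<in>S. indicator (F a b) y * g b) \<partial>Q)"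
  proof (rule Bochner_Integration.integral_cong[OF refl])
    fix y assume y: "y \<in> space Q"
    have "(\<Sum>b\<in>S. indicator (F a b) y * g b) = indicator (E a) y * g (y (Suc k))" for a
    proof -
      have "(\<Sum>b\<in>S. indicator (F a b) y * g b) =
          (\<Sum>b\<in>S. if b = y (Suc k) then indicator (E a) y * g b else 0)"
        by (rule sum.cong) (auto simp: E_def F_def indicator_def)
      thus ?thesis using S space_Q[OF y] by simp
    qed
    thus "g (y (Suc k)) = (\<Sum>a\<in>H. \<Sum>b\<in>S. indicator (F a b) y * g b)"
      using split_H[OF y, of "\<lambda>_. g (y (Suc k))"] by simp
  qed
  also have "\<dots> = (\<Sum>a\<in>H. \<Sum>b\<in>S. Q.prob (F a b) * g b)"
    using int_F F_m by (simp add: Bochner_Integration.integral_sum)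
  also have "\<dots> = (\<Sum>a\<in>H. Q.prob (E a) * measure_pmf.expectation (K (a k)) g)"
  proof (rule sum.cong[OF refl])
    fix a assume a: "a \<in> H"
    have "measure_pmf.expectation (K (a k)) g = (\<Sum>b\<in>S. g b * pmf (K (a k)) b)"
      using K[OF a_S[OF a order_refl]] by (intro integral_measure_pmf_real[OF S]) auto
    thus "(\<Sum>b\<in>S. Q.prob (F a b) * g b) = Q.prob (E a) * measure_pmf.expectation (K (a k)) g"
      using prob_F[OF a] by (simp add: sum_distrib_left mult_ac cong: sum.cong)
  qed
  also have "\<dots> = (\<integral>y. (\<Sum>a\<in>H. indicator (E a) y * measure_pmf.expectation (K (a k)) g) \<partial>Q)"
    using int_E E_m by (simp add: Bochner_Integration.integral_sum)
  also have "\<dots> = (\<integral>y. measure_pmf.expectation (K (y k)) g \<partial>Q)"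
    using split_H by (intro Bochner_Integration.integral_cong) auto
  finally show ?thesis .
qed

lemma expectation_Y_trans:
  fixes f :: "int \<Rightarrow> real"
  assumes "0 \<le> p" "p \<le> 1"
  shows "measure_pmf.expectation (Y_trans p \<eta> N y) f = p * f (max (y - 1) \<eta>) + (1 - p) * f N"
  using assms by (simp add: Y_trans_def integral_bernoulli_pmf)

lemma set_pmf_Y_trans: "y \<in> {\<eta>..N} \<Longrightarrow> set_pmf (Y_trans p \<eta> N y) \<subseteq> {\<eta>..N}"
  by (auto simp: Y_trans_def)

section \<open>The sample space and the stochastic order\<close>

lemma prob_space_Omega: "prob_space Omega"
  unfolding Omega_def by (intro prob_space_PiM prob_space_restrict_space) auto

lemma sequence_space_Omega: "sequence_space Omega"
proof -
  interpret prob_space Omega by (rule prob_space_Omega)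
  show ?thesis by unfold_locales
qed

theorem theorem4p1:
  fixes T :: "real ^ 's \<Rightarrow> real ^ 's"
    and That :: "nat \<Rightarrow> (nat \<Rightarrow> real) \<Rightarrow> real ^ 's \<Rightarrow> real ^ 's"
    and v0 :: "nat \<Rightarrow> real ^ 's"
    and vstar :: "real ^ 's"
    and \<alpha> \<kappa> \<epsilon>g :: real
    and p :: "real \<Rightarrow> nat \<Rightarrow> real"
    and n :: nat
    and Q :: "(nat \<Rightarrow> int) measure"
  assumes alpha: "0 < \<alpha>" "\<alpha> < 1"
    and That_measurable:
      "\<And>m. m \<ge> 1 \<Longrightarrow> (\<lambda>(\<omega>, v). That m \<omega> v) \<in> borel_measurable (Omega \<Otimes>\<^sub>M borel)"
    and seed: "\<And>m. m \<ge> 1 \<Longrightarrow> infnorm (v0 m) \<le> \<kappa>"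
    and A1: "\<And>v. AE \<omega> in Omega. (\<lambda>m. infnorm (That m \<omega> v - T v)) \<longlonglongrightarrow> 0"
    and fixpoint: "T vstar = vstar"
    and A2: "infnorm vstar \<le> \<kappa>"
      "\<And>m k. m \<ge> 1 \<Longrightarrow> AE \<omega> in Omega_seq. infnorm (rand_iter (That m) k \<omega> (v0 m)) \<le> \<kappa>"
    and A3: "\<And>v. infnorm (T v - vstar) \<le> \<alpha> * infnorm (v - vstar)"
    and A4: "\<And>\<epsilon> m v. \<epsilon> > 0 \<Longrightarrow> m \<ge> 1 \<Longrightarrow> infnorm v \<le> \<kappa> \<Longrightarrow>
        \<P>(\<omega> in Omega. infnorm (T v - That m \<omega> v) < \<epsilon>) > p \<epsilon> m"
      "\<And>\<epsilon>. \<epsilon> > 0 \<Longrightarrow> mono_on {1..} (p \<epsilon>)"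
      "\<And>\<epsilon>. \<epsilon> > 0 \<Longrightarrow> p \<epsilon> \<longlonglongrightarrow> 1"
    and granularity: "\<epsilon>g > 0"
    and n: "n \<ge> 1"
    and p_n: "0 < p \<epsilon>g n" "p \<epsilon>g n < 1"
    and eta_le_N: "eta_star \<alpha> \<le> Nstar \<kappa> \<epsilon>g"
    and Y_chain: "markov_chain_law {eta_star \<alpha>..Nstar \<kappa> \<epsilon>g}
        (Y_trans (p \<epsilon>g n) (eta_star \<alpha>) (Nstar \<kappa> \<epsilon>g)) Q"
    and init: "\<And>\<omega>. \<omega> \<in> space Omega_seq \<Longrightarrow>
        AE y in Q. err \<epsilon>g vstar (That n) (v0 n) 0 \<omega> = y 0"
  shows "\<forall>k. stoch_le Omega_seq (\<lambda>\<omega>. real_of_int (err \<epsilon>g vstar (That n) (v0 n) k \<omega>))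
                      Q (\<lambda>y. real_of_int (y k))"
proof -
  interpret seq: sequence_space Omega by (rule sequence_space_Omega)
  define \<eta> where "\<eta> = eta_star \<alpha>"
  define N where "N = Nstar \<kappa> \<epsilon>g"
  define q where "q = p \<epsilon>g n"
  define X where "X = err \<epsilon>g vstar (That n) (v0 n)"
  have q: "0 \<le> q" "q \<le> 1" using p_n by (auto simp: q_def)
  have \<eta>N: "\<eta> \<le> N" using eta_le_N by (simp add: \<eta>_def N_def)
  have law: "markov_chain_law {\<eta>..N} (Y_trans q \<eta> N) Q"
    using Y_chain by (simp add: \<eta>_def N_def q_def)
  interpret O: prob_space Omega_seq
    unfolding Omega_seq_def by (intro prob_space_PiM prob_space_Omega)
  interpret Q: prob_space Q using law by (simp add: markov_chain_law_def)
  have X_m: "X k \<in> Omega_seq \<rightarrow>\<^sub>M count_space UNIV" for k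
    unfolding X_def Omega_seq_def by (rule measurable_err[OF That_measurable[OF n]])
  have sets_Q: "sets Q = sets (PiM UNIV (\<lambda>_. count_space {\<eta>..N}))"
    using law by (simp add: markov_chain_law_def)
  have Y_S: "\<eta> \<le> y k \<and> y k \<le> N" if "y \<in> space Q" for y k
    using that sets_eq_imp_space_eq[OF sets_Q] by (auto simp: space_PiM PiE_def Pi_iff)
  have Y_m: "(\<lambda>y. y k) \<in> Q \<rightarrow>\<^sub>M count_space UNIV" for k
  proof -
    have "(\<lambda>y. y k) \<in> Q \<rightarrow>\<^sub>M count_space {\<eta>..N}"
      by (subst measurable_cong_sets[OF sets_Q refl]) simp
    from measurable_compose[OF this, of "\<lambda>i. i" "count_space UNIV"] show ?thesis by simp
  qed
  have Y_int: "integrable Q (\<lambda>y. f (y k))" if "mono f" for f :: "int \<Rightarrow> real" and k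
    using Y_S by (intro Q.integrable_mono_between[OF that Y_m, where a = \<eta> and b = N]) auto
  have compare: "(\<integral>\<omega>. f (X k \<omega>) \<partial>Omega_seq) \<le> (\<integral>y. f (y k) \<partial>Q)"
    if "mono f" for f :: "int \<Rightarrow> real" and k
    using that
  proof (induction k arbitrary: f)
    case 0
    define x0 where "x0 = \<lceil>infnorm (v0 n - vstar) / \<epsilon>g\<rceil>"
    have X0: "X 0 \<omega> = x0" for \<omega> by (simp add: X_def err_def x0_def)
    obtain \<omega> where "\<omega> \<in> space Omega_seq" using O.not_empty by blast
    from init[OF this] have "AE y in Q. f x0 = f (y 0)"
      unfolding X_def[symmetric] X0 by eventually_elim simp
    hence "(\<integral>y. f (y 0) \<partial>Q) = (\<integral>y. f x0 \<partial>Q)"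
      using Y_int[OF 0] by (intro integral_cong_AE) auto
    thus ?case by (simp add: X0 O.prob_space Q.prob_space)
  next
    case (Suc k)
    define g where "g = (\<lambda>i. f (min N (max (i - 1) \<eta>)))"
    have g: "mono g" unfolding g_def by (intro monoI monoD[OF Suc.prems]) auto
    have "(\<integral>\<omega>. f (X (Suc k) \<omega>) \<partial>Omega_seq) \<le>
        q * (\<integral>\<omega>. g (X k \<omega>) \<partial>Omega_seq) + (1 - q) * f N"
      unfolding X_def g_def \<eta>_def N_def Omega_seq_def
    proof (rule seq.expectation_ceiling_error_step[OF alpha granularity eta_le_N
          That_measurable[OF n] A2(1) _ A3 _ Suc.prems])
      show "AE \<omega> in PiM UNIV (\<lambda>_. Omega). infnorm (rand_iter (That n) k \<omega> (v0 n)) \<le> \<kappa>" for k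
        by (rule A2(2)[OF n, unfolded Omega_seq_def])
      show "q \<le> \<P>(x in Omega. infnorm (T v - That n x v) < \<epsilon>g)" if "infnorm v \<le> \<kappa>" for v
        using A4(1)[OF granularity n that] by (simp add: q_def)
    qed
    also have "\<dots> \<le> q * (\<integral>y. g (y k) \<partial>Q) + (1 - q) * f N"
      using Suc.IH[OF g] q by (intro add_right_mono mult_left_mono)
    also have "\<dots> = (\<integral>y. q * g (y k) + (1 - q) * f N \<partial>Q)"
      using Y_int[OF g] by (simp add: Q.prob_space)
    also have "\<dots> = (\<integral>y. measure_pmf.expectation (Y_trans q \<eta> N (y k)) f \<partial>Q)"
      \<comment> \<open>inside the state space the truncation at \<open>N\<close> in \<open>g\<close> is inactive\<close>
    proof (rule Bochner_Integration.integral_cong[OF refl])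
      fix y assume "y \<in> space Q"
      from Y_S[OF this, of k] \<eta>N have "min N (max (y k - 1) \<eta>) = max (y k - 1) \<eta>" by auto
      thus "q * g (y k) + (1 - q) * f N = measure_pmf.expectation (Y_trans q \<eta> N (y k)) f"
        by (simp add: g_def expectation_Y_trans[OF q])
    qed
    also have "\<dots> = (\<integral>y. f (y (Suc k)) \<partial>Q)"
      using set_pmf_Y_trans
      by (intro markov_chain_law_expectation_Suc[OF law, symmetric]) auto
    finally show ?case .
  qed
  show ?thesis unfolding X_def[symmetric]
  proof (intro allI)
    fix k
    show "stoch_le Omega_seq (\<lambda>\<omega>. real_of_int (X k \<omega>)) Q (\<lambda>y. real_of_int (y k))"
      unfolding stoch_le_def
    proof (intro conjI allI impI)
      show "(\<lambda>\<omega>. real_of_int (X k \<omega>)) \<in> borel_measurable Omega_seq"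
        using measurable_compose[OF X_m, of real_of_int borel] by simp
      show "(\<lambda>y. real_of_int (y k)) \<in> borel_measurable Q"
        using measurable_compose[OF Y_m, of real_of_int borel] by simp
      fix f :: "real \<Rightarrow> real" assume "mono f"
      hence "mono (\<lambda>i. f (real_of_int i))" by (intro monoI) (simp add: monoD)
      from compare[OF this]
      show "(\<integral>\<omega>. f (real_of_int (X k \<omega>)) \<partial>Omega_seq) \<le> (\<integral>y. f (real_of_int (y k)) \<partial>Q)" .
    qed
  qed
qed

end
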